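(* Assume $\theta_k > \theta_{k+1}$ and $c < 10^{-4}$. For any (possibly adaptive) algorithm $A$, if $A$ uses $c \sum_{i:\, k+1\leq i,\ \theta_i \geq \theta_k/2} \frac{\theta_k^2}{(\theta_k- \theta_i)^2}$ comparisons of any size (sets of any size between $2$ and $n$), then $A$ identifies the top-$k$ items with probability at most $7/8$. This holds even if $A$ is given the values $\{\theta_1,\dots,\theta_n\}$.
   Context: MNL model: $n$ items with positive scores $\theta_1\ge\theta_2\ge\cdots\ge\theta_n$; the top-$k$ items are those with scores $\theta_1,\dots,\theta_k$. The algorithm sees the items only via labels given by a uniformly random permutation $\pi$ of $[n]$ (item with score $\theta_i$ has label $\pi_i$); it may know the multiset of score values but not which label carries which score. In each round it chooses (adaptively) a set $S$ of at least two items and observes one item $a\in S$ with probability $\theta_a/\sum_{j\in S}\theta_j$, independently of the past given $S$. Each round is one comparison. Success means outputting $\{\pi_1,\dots,\pi_k\}$; probability is over $\pi$, outcomes and the algorithm's randomness. *)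

theory Defs
  imports "HOL-Probability.Probability" "HOL-Combinatorics.Permutations"
begin

text \<open>
  Items are addressed by labels in \<open>{1..n}\<close>; \<open>w a\<close> is the score of the item with label \<open>a\<close>.
  The use of \<open>embed_pmf\<close> is justified by \<open>pmf_winner_pmf\<close> below.
\<close>

definition winner_pmf :: "(nat \<Rightarrow> real) \<Rightarrow> nat set \<Rightarrow> nat pmf" where
  "winner_pmf w S = embed_pmf (\<lambda>a. if a \<in> S then w a / (\<Sum>j\<in>S. w j) else 0)"

lemma pmf_winner_pmf:
  assumes "finite S" "S \<noteq> {}" "\<And>j. j \<in> S \<Longrightarrow> 0 < w j"
  shows "pmf (winner_pmf w S) a = (if a \<in> S then w a / (\<Sum>j\<in>S. w j) else 0)"
proof -
  let ?f = "\<lambda>a. if a \<in> S then w a / (\<Sum>j\<in>S. w j) else 0"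
  have pos: "0 < (\<Sum>j\<in>S. w j)"
    using assms by (intro sum_pos) auto
  have nonneg: "0 \<le> ?f x" for x
    using assms(3) pos by (simp add: less_imp_le)
  have "(\<integral>\<^sup>+x. ennreal (?f x) \<partial>count_space UNIV) = (\<Sum>x\<in>S. ennreal (?f x))"
    by (rule nn_integral_count_space') (use assms in auto)
  also have "\<dots> = ennreal (\<Sum>x\<in>S. ?f x)"
    by (rule sum_ennreal) (rule nonneg)
  also have "(\<Sum>x\<in>S. ?f x) = 1"
    using pos by (simp flip: sum_divide_distrib)
  finally have total: "(\<integral>\<^sup>+x. ennreal (?f x) \<partial>count_space UNIV) = 1"
    by simp
  show ?thesis
    unfolding winner_pmf_def by (rule pmf_embed_pmf) (fact nonneg, fact total)
qed

text \<open>
  An adaptive algorithm, once its random seed is fixed, is a decision tree: it either stops and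
  returns a set of labels, or compares the items in \<open>S\<close> and continues with \<open>f a\<close> on observing
  the winner \<open>a\<close>. Subtrees \<open>f a\<close> with \<open>a \<notin> S\<close> are never reached.
\<close>

datatype algorithm =
    Output "nat set"
  | Compare "nat set" "nat \<Rightarrow> algorithm"

primrec valid_algorithm :: "nat \<Rightarrow> algorithm \<Rightarrow> bool" where
  "valid_algorithm n (Output R) \<longleftrightarrow> True"
| "valid_algorithm n (Compare S f) \<longleftrightarrow>
     S \<subseteq> {1..n} \<and> 2 \<le> card S \<and> (\<forall>a\<in>S. valid_algorithm n (f a))"

text \<open>The number of comparisons is bounded along every branch, i.e. in the worst case.\<close>

primrec uses_at_most :: "algorithm \<Rightarrow> nat \<Rightarrow> bool" where
  "uses_at_most (Output R) T \<longleftrightarrow> True"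
| "uses_at_most (Compare S f) T \<longleftrightarrow> 1 \<le> T \<and> (\<forall>a\<in>S. uses_at_most (f a) (T - 1))"

primrec output_pmf :: "(nat \<Rightarrow> real) \<Rightarrow> algorithm \<Rightarrow> nat set pmf" where
  "output_pmf w (Output R) = return_pmf R"
| "output_pmf w (Compare S f) = bind_pmf (winner_pmf w S) (\<lambda>a. output_pmf w (f a))"

text \<open>
  Joint law of the labelling and the returned set. The item of score \<open>\<theta> i\<close> carries the label
  \<open>\<pi> i\<close>, hence label \<open>a\<close> has score \<open>\<theta> (inv \<pi> a)\<close>; the algorithm itself does not see \<open>\<pi>\<close>.
\<close>

definition labelled_run :: "nat \<Rightarrow> (nat \<Rightarrow> real) \<Rightarrow> algorithm \<Rightarrow> ((nat \<Rightarrow> nat) \<times> nat set) pmf" where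
  "labelled_run n \<theta> A = do {
     \<pi> \<leftarrow> pmf_of_set {\<pi>. \<pi> permutes {1..n}};
     R \<leftarrow> output_pmf (\<lambda>a. \<theta> (inv \<pi> a)) A;
     return_pmf (\<pi>, R)
   }"

text \<open>
  A randomized algorithm is a family of decision trees indexed by a seed drawn from a probability
  space \<open>M\<close>, independently of the labelling and of the comparison outcomes. The last condition
  makes the law of a run a probability kernel in the seed.
\<close>

definition randomized_algorithm ::
    "nat \<Rightarrow> (nat \<Rightarrow> real) \<Rightarrow> 'r measure \<Rightarrow> ('r \<Rightarrow> algorithm) \<Rightarrow> bool" where
  "randomized_algorithm n \<theta> M A \<longleftrightarrow>
     prob_space M \<and>
     (\<forall>r\<in>space M. valid_algorithm n (A r)) \<and>
     (\<forall>\<pi> R. (\<lambda>r. pmf (labelled_run n \<theta> (A r)) (\<pi>, R)) \<in> borel_measurable M)"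

definition success_prob ::
    "nat \<Rightarrow> nat \<Rightarrow> (nat \<Rightarrow> real) \<Rightarrow> 'r measure \<Rightarrow> ('r \<Rightarrow> algorithm) \<Rightarrow> real" where
  "success_prob n k \<theta> M A =
     (\<integral>r. measure_pmf.prob (labelled_run n \<theta> (A r)) {(\<pi>, R). R = \<pi> ` {1..k}} \<partial>M)"

end

theory Submission imports Defs begin

text \<open>
  Fix the seed. The expected numbers of wins of the items \<open>i > k\<close> add up to at most \<open>T\<close>, so some
  such \<open>i\<close> has \<open>((\<theta> k - \<theta> i) / \<theta> i)\<^sup>2\<close> times its expected number of wins at most \<open>4 / 10 ^ 4\<close>. Raise the
  score of this item to \<open>\<theta> k\<close>. The raised instance is invariant under exchanging \<open>k\<close> and \<open>i\<close>, which
  changes the correct answer, so there the success probability is at most \<open>1/2\<close>. The relative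
  entropy of the true run with respect to the raised one is at most \<open>4 / 10 ^ 4\<close>, because a comparison
  \<open>S\<close> contributes at most \<open>((\<theta> k - \<theta> i) / \<theta> i)\<^sup>2\<close> times the probability that \<open>i\<close> wins it. Hence the
  true success probability exceeds \<open>1/2\<close> only slightly.
\<close>

section \<open>Laws of a single comparison and of a run\<close>

lemma prob_bind_pmf:
  "measure_pmf.prob (bind_pmf M N) X = measure_pmf.expectation M (\<lambda>x. measure_pmf.prob (N x) X)"
proof -
  have "integrable (measure_pmf M) (\<lambda>x. measure_pmf.prob (N x) X)"
    by (rule measure_pmf.integrable_const_bound[where B = 1]) auto
  then have "ennreal (measure_pmf.prob (bind_pmf M N) X)
      = ennreal (measure_pmf.expectation M (\<lambda>x. measure_pmf.prob (N x) X))"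
    by (simp add: measure_pmf.emeasure_eq_measure[symmetric] nn_integral_eq_integral[symmetric])
  then show ?thesis
    by (simp add: integral_nonneg_AE)
qed

text \<open>For \<open>x > 1\<close> the left side is negative. Having \<open>x\<close> itself as
  the linear term is what makes the relative entropy of one comparison quadratic in the
  raise.\<close>

lemma ln_one_plus_ge:
  fixes x :: real
  assumes "0 \<le> x"
  shows "x - x\<^sup>2 \<le> ln (1 + x)"
proof (cases "x \<le> 1")
  case True
  then show ?thesis using ln_one_plus_pos_lower_bound assms by blast
next
  case False
  then have "x * 1 \<le> x * x" by (intro mult_left_mono) auto
  moreover have "0 \<le> ln (1 + x)" using assms by simp
  ultimately show ?thesis by (simp add: power2_eq_square)
qed

lemma expectation_winner_pmf:
  fixes w f :: "nat \<Rightarrow> real"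
  assumes "finite S" "S \<noteq> {}" "\<And>j. j \<in> S \<Longrightarrow> 0 < w j"
  shows "measure_pmf.expectation (winner_pmf w S) f = (\<Sum>j\<in>S. w j / sum w S * f j)"
proof -
  have "measure_pmf.expectation (winner_pmf w S) f = (\<Sum>j\<in>S. f j * pmf (winner_pmf w S) j)"
    by (rule integral_measure_pmf_real)
      (use assms in \<open>auto simp: set_pmf_eq pmf_winner_pmf split: if_splits\<close>)
  also have "\<dots> = (\<Sum>j\<in>S. w j / sum w S * f j)"
    by (rule sum.cong) (use assms in \<open>simp_all add: pmf_winner_pmf\<close>)
  finally show ?thesis .
qed

lemma prob_output_Compare:
  assumes "finite S" "S \<noteq> {}" "\<And>j. j \<in> S \<Longrightarrow> 0 < w j"
  shows "measure_pmf.prob (output_pmf w (Compare S f)) X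
    = (\<Sum>j\<in>S. w j / sum w S * measure_pmf.prob (output_pmf w (f j)) X)"
  by (simp add: prob_bind_pmf expectation_winner_pmf[OF assms])

lemma prob_labelled_run:
  "measure_pmf.prob (labelled_run n \<theta> D) {(\<pi>, R). R = g \<pi>}
    = (\<Sum>\<pi> | \<pi> permutes {1..n}. measure_pmf.prob (output_pmf (\<lambda>a. \<theta> (inv \<pi> a)) D) {g \<pi>}) / fact n"
proof -
  let ?P = "{\<pi>. \<pi> permutes {1..n}}"
  have P: "finite ?P" "?P \<noteq> {}" "card ?P = fact n"
    using finite_permutations[of "{1..n}"] card_permutations[of "{1..n}" n]
    by (auto intro: permutes_id)
  have [simp]: "indicator {(\<pi>, R). R = g \<pi>} (x, R) = indicator {g x} R" for x R
    by (simp add: indicator_def)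
  have "measure_pmf.prob (labelled_run n \<theta> D) {(\<pi>, R). R = g \<pi>}
      = measure_pmf.expectation (pmf_of_set ?P)
          (\<lambda>\<pi>. measure_pmf.prob (output_pmf (\<lambda>a. \<theta> (inv \<pi> a)) D) {g \<pi>})"
    unfolding labelled_run_def prob_bind_pmf
    by (simp add: measure_return_pmf)
  then show ?thesis
    using P by (simp add: integral_pmf_of_set)
qed

section \<open>Expected numbers of wins\<close>

text \<open>Recursion on the tree gives the expectation as finite sums, without random variables on
  its branches: \<open>of_bool\<close> counts the comparison at the root, the recursive call the
  later ones.\<close>

primrec expected_wins :: "(nat \<Rightarrow> real) \<Rightarrow> algorithm \<Rightarrow> nat \<Rightarrow> real" where
  "expected_wins w (Output R) = (\<lambda>a. 0)"
| "expected_wins w (Compare S f) =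
     (\<lambda>a. \<Sum>j\<in>S. w j / sum w S * (of_bool (j = a) + expected_wins w (f j) a))"

lemma expected_wins_nonneg:
  assumes "valid_algorithm n D" "\<And>j. j \<in> {1..n} \<Longrightarrow> 0 < w j"
  shows "0 \<le> expected_wins w D a"
  using assms(1)
proof (induction D)
  case (Compare S f)
  have "0 \<le> w j" if "j \<in> S" for j
    using that Compare.prems assms(2)[of j] by auto
  then show ?case
    using Compare by (auto intro!: sum_nonneg mult_nonneg_nonneg divide_nonneg_nonneg)
qed simp

text \<open>A comparison has exactly one winner, so it adds at most 1 to the total over any finite
  set of labels.\<close>

lemma sum_expected_wins_le:
  assumes "valid_algorithm n D" "\<And>j. j \<in> {1..n} \<Longrightarrow> 0 < w j" "uses_at_most D T" "finite U"
  shows "(\<Sum>a\<in>U. expected_wins w D a) \<le> real T"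
  using assms(1,3)
proof (induction D arbitrary: T)
  case (Compare S f)
  have S: "finite S" "S \<noteq> {}" "\<And>j. j \<in> S \<Longrightarrow> 0 < w j"
    using Compare.prems(1) assms(2) by (auto intro: finite_subset)
  then have W: "0 < sum w S" by (intro sum_pos) auto
  have T: "1 \<le> T" using Compare.prems by simp
  have "(\<Sum>a\<in>U. expected_wins w (Compare S f) a)
      = (\<Sum>j\<in>S. w j / sum w S * ((\<Sum>a\<in>U. of_bool (j = a)) + (\<Sum>a\<in>U. expected_wins w (f j) a)))"
    unfolding expected_wins.simps sum.distrib[symmetric] sum_distrib_left by (rule sum.swap)
  also have "\<dots> \<le> (\<Sum>j\<in>S. w j / sum w S * (1 + real (T - 1)))"
  proof (intro sum_mono mult_left_mono add_mono)
    fix j assume j: "j \<in> S"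
    show "(\<Sum>a\<in>U. of_bool (j = a)) \<le> (1::real)"
      using assms(4) by (simp add: of_bool_def)
    show "(\<Sum>a\<in>U. expected_wins w (f j) a) \<le> real (T - 1)"
      by (rule Compare.IH) (use Compare.prems j in auto)
    show "0 \<le> w j / sum w S"
      using S(3)[OF j] W by simp
  qed
  also have "\<dots> = real T"
    using W T by (simp add: of_nat_diff flip: sum_divide_distrib sum_distrib_right)
  finally show ?case .
qed simp

section \<open>Effect of raising one score\<close>

lemma sum_raised_weight:
  fixes w :: "nat \<Rightarrow> real"
  assumes "finite S" "b \<in> S"
  shows "sum (w(b := v)) S = sum w S + (v - w b)"
proof -
  have "sum (w(b := v)) S = v + sum (w(b := v)) (S - {b})"
    using assms by (simp add: sum.remove)
  also have "sum (w(b := v)) (S - {b}) = sum w (S - {b})"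
    by (rule sum.cong) auto
  also have "\<dots> = sum w S - w b"
    using assms by (simp add: sum_diff1)
  finally show ?thesis by simp
qed

text \<open>The left-hand side is the relative entropy of the two laws of the winner.\<close>

lemma winner_relative_entropy_le:
  fixes w :: "nat \<Rightarrow> real"
  assumes "finite S" "S \<noteq> {}" "\<And>j. j \<in> S \<Longrightarrow> 0 < w j" "0 < w b" "w b \<le> v"
  defines "w' \<equiv> w(b := v)"
  shows "(\<Sum>j\<in>S. w j / sum w S * ln ((w j / sum w S) / (w' j / sum w' S)))
    \<le> (\<Sum>j\<in>S. w j / sum w S * (((v - w b) / w b)\<^sup>2 * of_bool (j = b)))"
proof (cases "b \<in> S")
  case False
  then have same: "w' j = w j" if "j \<in> S" for j using that by (auto simp: w'_def)
  then have "sum w' S = sum w S" by (intro sum.cong) auto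
  then have "(\<Sum>j\<in>S. w j / sum w S * ln ((w j / sum w S) / (w' j / sum w' S))) = 0"
    using same by (intro sum.neutral) auto
  moreover have "0 \<le> w j" if "j \<in> S" for j using assms(3)[OF that] by simp
  ultimately show ?thesis
    by (auto intro!: sum_nonneg mult_nonneg_nonneg divide_nonneg_nonneg)
next
  case b: True
  define W where "W = sum w S"
  define d where "d = v - w b"
  have d: "0 \<le> d" and W: "0 < W"
    using assms by (auto simp: d_def W_def intro: sum_pos)
  have W': "sum w' S = W + d"
    using sum_raised_weight[OF assms(1) b] by (simp add: w'_def W_def d_def)
  have pos: "0 < 1 + d / W" "0 < 1 + d / w b"
    using d W assms(4) by (simp_all add: add_pos_nonneg)
  \<comment> \<open>The raise multiplies the total weight by \<open>1 + d / W\<close> and the weight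
    of \<open>b\<close> by \<open>1 + d / w b\<close>. Only these two factors survive in the
    likelihood ratios.\<close>
  have term_eq: "w j / W * ln ((w j / W) / (w' j / (W + d)))
      = w j / W * ln (1 + d / W) - w j / W * (ln (1 + d / w b) * of_bool (j = b))"
    if "j \<in> S" for j
  proof (cases "j = b")
    case True
    have "(w b / W) / (v / (W + d)) = (1 + d / W) / (1 + d / w b)"
      using assms(4,5) W d by (simp add: d_def field_simps)
    then have "ln ((w b / W) / (v / (W + d))) = ln (1 + d / W) - ln (1 + d / w b)"
      using pos by (simp add: ln_div)
    then have "ln ((w j / W) / (w' j / (W + d))) = ln (1 + d / W) - ln (1 + d / w b)"
      by (simp only: True w'_def fun_upd_same)
    then show ?thesis
      by (simp only: True right_diff_distrib simp_thms of_bool_eq mult_1_right)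
  next
    case False
    have "(w j / W) / (w j / (W + d)) = 1 + d / W"
      using assms(3)[OF that] W d by (simp add: field_simps)
    then show ?thesis using False by (simp add: w'_def)
  qed
  have ind: "(\<Sum>j\<in>S. w j / W * (z * of_bool (j = b))) = w b / W * z" for z
    using b assms(1) by (simp add: of_bool_def if_distrib cong: if_cong)
  have "(\<Sum>j\<in>S. w j / W * ln ((w j / W) / (w' j / (W + d))))
      = (\<Sum>j\<in>S. w j / W * ln (1 + d / W) - w j / W * (ln (1 + d / w b) * of_bool (j = b)))"
    by (intro sum.cong refl term_eq)
  also have "\<dots> = (\<Sum>j\<in>S. w j / W * ln (1 + d / W)) - w b / W * ln (1 + d / w b)"
    by (simp only: sum_subtractf ind)
  also have "(\<Sum>j\<in>S. w j / W * ln (1 + d / W)) = ln (1 + d / W)"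
    using W by (simp add: W_def flip: sum_distrib_right sum_divide_distrib)
  \<comment> \<open>The bound \<open>d / W\<close> on the first logarithm cancels the linear part of
    the bound on the second. The quadratic remainder carries the factor \<open>w b / W\<close>, the
    probability that \<open>b\<close> wins; hence wins of \<open>b\<close> are counted, not its
    appearances.\<close>
  also have "ln (1 + d / W) - w b / W * ln (1 + d / w b)
      \<le> d / W - w b / W * (d / w b - (d / w b)\<^sup>2)"
    using d W assms(4) by (intro diff_mono mult_left_mono ln_one_plus_ge ln_add_one_self_le_self) auto
  also have "\<dots> = w b / W * (d / w b)\<^sup>2"
    using assms(4) by (simp add: right_diff_distrib)
  finally show ?thesis
    unfolding W' ind[unfolded W_def d_def] W_def[symmetric] d_def[symmetric] ind .
qed

text \<open>Gibbs variational inequality on a finite set. With \<open>Y\<close> the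
  \<open>q\<close>-mean of \<open>x\<close>, apply \<open>ln y \<le> y - 1\<close> to
  \<open>y = q j * x j / (p j * Y)\<close>, multiply by \<open>p j\<close> and sum: the right sides
  add up to \<open>Y / Y - 1 = 0\<close>.\<close>

lemma sum_ln_le:
  fixes p q x :: "'a \<Rightarrow> real"
  assumes "finite S" "S \<noteq> {}" "\<And>j. j \<in> S \<Longrightarrow> 0 < p j" "\<And>j. j \<in> S \<Longrightarrow> 0 < q j"
    "\<And>j. j \<in> S \<Longrightarrow> 0 < x j" "sum p S = 1"
  shows "(\<Sum>j\<in>S. p j * ln (x j)) \<le> ln (\<Sum>j\<in>S. q j * x j) + (\<Sum>j\<in>S. p j * ln (p j / q j))"
proof -
  define Y where "Y = (\<Sum>j\<in>S. q j * x j)"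
  have Y: "0 < Y" unfolding Y_def using assms by (intro sum_pos) auto
  have "p j * ln (x j) \<le> p j * ln Y + q j * x j / Y - p j + p j * ln (p j / q j)" if "j \<in> S" for j
  proof -
    note pos = assms(3-5)[OF that]
    have "ln (x j) - ln Y - ln (p j / q j) = ln (q j * x j / (p j * Y))"
      using pos Y by (simp add: ln_div ln_mult)
    also have "\<dots> \<le> q j * x j / (p j * Y) - 1"
      using pos Y by (intro ln_le_minus_one) simp
    finally have "p j * (ln (x j) - ln Y - ln (p j / q j)) \<le> p j * (q j * x j / (p j * Y) - 1)"
      using pos by (intro mult_left_mono) auto
    also have "\<dots> = q j * x j / Y - p j"
      using pos by (simp add: field_simps)
    finally show ?thesis by (simp add: algebra_simps)
  qed
  then have "(\<Sum>j\<in>S. p j * ln (x j))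
      \<le> (\<Sum>j\<in>S. p j * ln Y + q j * x j / Y - p j + p j * ln (p j / q j))"
    by (rule sum_mono)
  also have "\<dots> = ln Y + Y / Y - 1 + (\<Sum>j\<in>S. p j * ln (p j / q j))"
    by (simp add: sum.distrib sum_subtractf assms(6) Y_def flip: sum_distrib_right sum_divide_distrib)
  finally show ?thesis using Y by (simp add: Y_def)
qed

text \<open>
  The Donsker-Varadhan bound for \<open>t\<close> times the indicator of \<open>X\<close>. It is the form
  of the relative entropy inequality that passes through the induction on the decision tree.
\<close>

lemma prob_output_change_score:
  assumes "valid_algorithm n D" "\<And>j. j \<in> {1..n} \<Longrightarrow> 0 < w j" "b \<in> {1..n}" "w b \<le> v"
    and t: "0 \<le> t"
  shows "t * measure_pmf.prob (output_pmf w D) X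
    \<le> ln (1 + (exp t - 1) * measure_pmf.prob (output_pmf (w(b := v)) D) X)
      + ((v - w b) / w b)\<^sup>2 * expected_wins w D b"
  using assms(1)
proof (induction D)
  case (Output R)
  \<comment> \<open>At a leaf both laws are the same point mass, and equality holds: both sides are
    0, or both are \<open>t = ln (exp t)\<close>.\<close>
  then show ?case by (simp add: measure_return_pmf indicator_def)
next
  case (Compare S f)
  define w' where "w' = w(b := v)"
  define p where "p = (\<lambda>j. w j / sum w S)"
  define q where "q = (\<lambda>j. w' j / sum w' S)"
  define L where "L = ((v - w b) / w b)\<^sup>2"
  define P where "P = (\<lambda>j. measure_pmf.prob (output_pmf w (f j)) X)"
  define Q where "Q = (\<lambda>j. measure_pmf.prob (output_pmf w' (f j)) X)"
  \<comment> \<open>\<open>x j\<close> is the mean of \<open>exp\<close> of \<open>t\<close> times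
    the indicator of \<open>X\<close> once \<open>j\<close> has won, under the raised scores. Its
    \<open>q\<close>-mean is the same quantity at the root, which closes the induction.\<close>
  define x where "x = (\<lambda>j. 1 + (exp t - 1) * Q j)"
  have S: "finite S" "S \<noteq> {}"
    using Compare.prems by (auto intro: finite_subset)
  have w: "0 < w j" if "j \<in> S" for j
    using that Compare.prems assms(2)[of j] by auto
  have wb: "0 < w b" using assms by auto
  have w': "0 < w' j" if "j \<in> S" for j
    using w[OF that] wb assms(4) by (simp add: w'_def)
  have sums: "0 < sum w S" "0 < sum w' S"
    using S w w' by (auto intro: sum_pos)
  have p: "0 < p j" and q: "0 < q j" if "j \<in> S" for j
    using that sums w w' by (auto simp: p_def q_def)
  have p1: "sum p S = 1" and q1: "sum q S = 1"
    using sums by (simp_all add: p_def q_def flip: sum_divide_distrib)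
  have x: "0 < x j" for j
    using t by (simp add: x_def Q_def add_pos_nonneg)
  have "t * measure_pmf.prob (output_pmf w (Compare S f)) X = (\<Sum>j\<in>S. p j * (t * P j))"
    by (simp only: prob_output_Compare[where w = w, OF S w] P_def p_def sum_distrib_left
        mult.left_commute)
  also have "\<dots> \<le> (\<Sum>j\<in>S. p j * (ln (x j) + L * expected_wins w (f j) b))"
  proof (intro sum_mono mult_left_mono)
    fix j assume j: "j \<in> S"
    show "t * P j \<le> ln (x j) + L * expected_wins w (f j) b"
      unfolding P_def x_def Q_def w'_def L_def
      by (rule Compare.IH) (use Compare.prems j in auto)
    show "0 \<le> p j" using p[OF j] by simp
  qed
  also have "\<dots> = (\<Sum>j\<in>S. p j * ln (x j)) + (\<Sum>j\<in>S. p j * (L * expected_wins w (f j) b))"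
    by (simp add: distrib_left sum.distrib)
  also have "(\<Sum>j\<in>S. p j * ln (x j))
      \<le> ln (\<Sum>j\<in>S. q j * x j) + (\<Sum>j\<in>S. p j * ln (p j / q j))"
    by (rule sum_ln_le) (use S p q x p1 in auto)
  also have "(\<Sum>j\<in>S. p j * ln (p j / q j)) \<le> (\<Sum>j\<in>S. p j * (L * of_bool (j = b)))"
    using winner_relative_entropy_le[where w = w, OF S w wb assms(4)]
    by (simp add: p_def q_def w'_def L_def)
  also have "(\<Sum>j\<in>S. q j * x j) = 1 + (exp t - 1) * (\<Sum>j\<in>S. q j * Q j)"
    by (simp add: x_def distrib_left sum.distrib q1 sum_distrib_left mult_ac)
  also have "(\<Sum>j\<in>S. q j * Q j) = measure_pmf.prob (output_pmf w' (Compare S f)) X"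
    by (simp only: prob_output_Compare[where w = w', OF S w'] q_def Q_def)
  finally have "t * measure_pmf.prob (output_pmf w (Compare S f)) X
      \<le> ln (1 + (exp t - 1) * measure_pmf.prob (output_pmf w' (Compare S f)) X)
        + ((\<Sum>j\<in>S. p j * (L * of_bool (j = b))) + (\<Sum>j\<in>S. p j * (L * expected_wins w (f j) b)))"
    by simp
  \<comment> \<open>The entropy of this comparison and the bounds from the subtrees combine exactly
    as in the recursion for \<open>expected_wins\<close>.\<close>
  also have "(\<Sum>j\<in>S. p j * (L * of_bool (j = b))) + (\<Sum>j\<in>S. p j * (L * expected_wins w (f j) b))
      = L * expected_wins w (Compare S f) b"
    by (simp only: expected_wins.simps sum_distrib_left sum.distrib[symmetric] p_def)
      (intro sum.cong refl, simp only: algebra_simps)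
  finally show ?case unfolding w'_def L_def .
qed

section \<open>Exchange symmetry of the raised instance\<close>

text \<open>The labellings \<pi> and \<open>\<pi> \<circ> s\<close>, with \<open>s\<close>
  exchanging \<open>k\<close> and \<open>i\<close>, give the same output law but different correct
  answers. The two answers are disjoint events, so their probabilities add up to at most 1.\<close>

lemma sum_prob_symmetric_le:
  fixes v :: "nat \<Rightarrow> real"
  assumes "1 \<le> k" "k < i" "i \<le> n" "v i = v k"
  shows "(\<Sum>\<pi> | \<pi> permutes {1..n}.
      measure_pmf.prob (output_pmf (\<lambda>a. v (inv \<pi> a)) D) {\<pi> ` {1..k}}) \<le> fact n / 2"
proof -
  let ?P = "{\<pi>. \<pi> permutes {1..n}}"
  define s where "s = Transposition.transpose k i"
  define Out where "Out = (\<lambda>\<pi>. output_pmf (\<lambda>a. v (inv \<pi> a)) D)"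
  have s: "s permutes {1..n}" unfolding s_def
    using assms by (intro permutes_swap_id) auto
  have Out: "Out (\<pi> \<circ> s) = Out \<pi>" if "\<pi> \<in> ?P" for \<pi>
  proof -
    have "inv (\<pi> \<circ> s) = s \<circ> inv \<pi>"
      using that permutes_bij[OF s] by (simp add: o_inv_distrib permutes_bij s_def)
    moreover have "v (s y) = v y" for y
      using assms(4) by (simp add: s_def Transposition.transpose_def)
    ultimately show ?thesis by (simp add: Out_def)
  qed
  have disj: "\<pi> ` {1..k} \<noteq> (\<pi> \<circ> s) ` {1..k}" if "\<pi> \<in> ?P" for \<pi>
  proof
    assume "\<pi> ` {1..k} = (\<pi> \<circ> s) ` {1..k}"
    moreover have "inj \<pi>" using that permutes_inj by auto
    ultimately have "{1..k} = s ` {1..k}"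
      by (simp only: image_comp[symmetric] inj_image_eq_iff)
    then have "s k \<in> {1..k}" using assms(1) by auto
    then show False using assms(2) by (simp add: s_def)
  qed
  have "(\<Sum>\<pi>\<in>?P. measure_pmf.prob (Out \<pi>) {\<pi> ` {1..k}})
      = (\<Sum>\<pi>\<in>?P. measure_pmf.prob (Out (\<pi> \<circ> s)) {(\<pi> \<circ> s) ` {1..k}})"
    by (rule sum_permutations_compose_right[OF s])
  also have "\<dots> = (\<Sum>\<pi>\<in>?P. measure_pmf.prob (Out \<pi>) {(\<pi> \<circ> s) ` {1..k}})"
    by (intro sum.cong refl arg_cong2[where f = measure_pmf.prob]) (rule Out)
  finally have "2 * (\<Sum>\<pi>\<in>?P. measure_pmf.prob (Out \<pi>) {\<pi> ` {1..k}})
      = (\<Sum>\<pi>\<in>?P. measure_pmf.prob (Out \<pi>) {\<pi> ` {1..k}}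
          + measure_pmf.prob (Out \<pi>) {(\<pi> \<circ> s) ` {1..k}})"
    by (simp add: sum.distrib)
  also have "\<dots> \<le> (\<Sum>\<pi>\<in>?P. 1)"
  proof (rule sum_mono)
    fix \<pi> assume "\<pi> \<in> ?P"
    then have "measure_pmf.prob (Out \<pi>) {\<pi> ` {1..k}} + measure_pmf.prob (Out \<pi>) {(\<pi> \<circ> s) ` {1..k}}
        = measure_pmf.prob (Out \<pi>) ({\<pi> ` {1..k}} \<union> {(\<pi> \<circ> s) ` {1..k}})"
      using disj by (subst measure_pmf.finite_measure_Union) auto
    then show "measure_pmf.prob (Out \<pi>) {\<pi> ` {1..k}} + measure_pmf.prob (Out \<pi>) {(\<pi> \<circ> s) ` {1..k}} \<le> 1"
      by simp
  qed
  also have "\<dots> = fact n" using card_permutations[of "{1..n}" n] by simp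
  finally show ?thesis by (simp add: Out_def)
qed

text \<open>Averages the change of score over all labellings. As \<open>t\<close> tends to 0 the
  first term tends to 1/2 while the entropy term grows like \<open>1 / t\<close>, so
  \<open>t\<close> is left free.\<close>

lemma prob_top_k_le:
  fixes \<theta> :: "nat \<Rightarrow> real"
  assumes "valid_algorithm n D" "1 \<le> k" "k < i" "i \<le> n" "\<theta> i \<le> \<theta> k" "0 < t"
    and pos: "\<And>j. j \<in> {1..n} \<Longrightarrow> 0 < \<theta> j"
  shows "measure_pmf.prob (labelled_run n \<theta> D) {(\<pi>, R). R = \<pi> ` {1..k}}
    \<le> (exp t - 1) / (2 * t) + ((\<theta> k - \<theta> i) / \<theta> i)\<^sup>2
        * (\<Sum>\<pi> | \<pi> permutes {1..n}. expected_wins (\<lambda>a. \<theta> (inv \<pi> a)) D (\<pi> i)) / fact n / t"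
proof -
  let ?P = "{\<pi>. \<pi> permutes {1..n}}"
  define P where "P = (\<lambda>\<pi>. measure_pmf.prob (output_pmf (\<lambda>a. \<theta> (inv \<pi> a)) D) {\<pi> ` {1..k}})"
  define Q where "Q = (\<lambda>\<pi>. measure_pmf.prob (output_pmf (\<lambda>a. (\<theta>(i := \<theta> k)) (inv \<pi> a)) D) {\<pi> ` {1..k}})"
  define N where "N = (\<lambda>\<pi>. expected_wins (\<lambda>a. \<theta> (inv \<pi> a)) D (\<pi> i))"
  define L where "L = ((\<theta> k - \<theta> i) / \<theta> i)\<^sup>2"
  have "t * P \<pi> \<le> (exp t - 1) * Q \<pi> + L * N \<pi>" if "\<pi> \<in> ?P" for \<pi>
  proof -
    have \<pi>: "\<pi> permutes {1..n}" using that by simp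
    have inv: "inv \<pi> (\<pi> i) = i" by (simp add: permutes_inverses[OF \<pi>])
    \<comment> \<open>Raising the label \<open>\<pi> i\<close> after labelling is raising the item
      \<open>i\<close> before it, so the symmetric instance is the same for every \<pi>.\<close>
    have upd: "(\<lambda>a. \<theta> (inv \<pi> a))(\<pi> i := \<theta> k) = (\<lambda>a. (\<theta>(i := \<theta> k)) (inv \<pi> a))"
      using permutes_inv_eq[OF \<pi>] by (auto simp: fun_eq_iff)
    have range: "inv \<pi> j \<in> {1..n}" if "j \<in> {1..n}" for j
      using that permutes_in_image[OF permutes_inv[OF \<pi>]] by blast
    have "t * P \<pi> \<le> ln (1 + (exp t - 1) * Q \<pi>) + L * N \<pi>"
      using prob_output_change_score[of n D "\<lambda>a. \<theta> (inv \<pi> a)" "\<pi> i" "\<theta> k" t "{\<pi> ` {1..k}}"]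
        assms range pos permutes_in_image[OF \<pi>, of i]
      by (simp only: upd inv P_def Q_def N_def L_def) auto
    \<comment> \<open>Making the bound linear in \<open>Q \<pi>\<close> allows summing over \<pi>
      before the symmetry is used.\<close>
    also have "ln (1 + (exp t - 1) * Q \<pi>) \<le> (exp t - 1) * Q \<pi>"
      using assms(6) by (intro ln_add_one_self_le_self) (simp add: Q_def)
    finally show ?thesis by simp
  qed
  then have "(\<Sum>\<pi>\<in>?P. t * P \<pi>) \<le> (\<Sum>\<pi>\<in>?P. (exp t - 1) * Q \<pi> + L * N \<pi>)"
    by (rule sum_mono)
  then have "t * sum P ?P \<le> (exp t - 1) * sum Q ?P + L * sum N ?P"
    by (simp add: sum.distrib flip: sum_distrib_left)
  also have "sum Q ?P \<le> fact n / 2"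
    unfolding Q_def using assms by (intro sum_prob_symmetric_le[where i = i]) auto
  finally have "t * sum P ?P \<le> (exp t - 1) * (fact n / 2) + L * sum N ?P"
    using assms(6) by (simp add: mult_left_mono)
  then have "t * sum P ?P / fact n / t \<le> ((exp t - 1) * (fact n / 2) + L * sum N ?P) / fact n / t"
    using assms(6) by (intro divide_right_mono) auto
  also have "\<dots> = (exp t - 1) / (2 * t) + L * sum N ?P / fact n / t"
    by (simp add: add_divide_distrib)
  finally have "sum P ?P / fact n \<le> (exp t - 1) / (2 * t) + L * sum N ?P / fact n / t"
    using assms(6) by simp
  then show ?thesis
    unfolding prob_labelled_run P_def N_def L_def .
qed

section \<open>Choice of the item and of the constants\<close>

lemma prob_top_k_le_seven_eighths:
  fixes \<theta> :: "nat \<Rightarrow> real"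
  assumes k: "1 \<le> k" "k < n"
    and pos: "\<And>i. i \<in> {1..n} \<Longrightarrow> 0 < \<theta> i"
    and mono: "\<And>i j. 1 \<le> i \<Longrightarrow> i \<le> j \<Longrightarrow> j \<le> n \<Longrightarrow> \<theta> j \<le> \<theta> i"
    and gap: "\<theta> k > \<theta> (k + 1)"
    and c: "c < 1 / 10 ^ 4"
    and D: "valid_algorithm n D" "uses_at_most D T"
    and T: "real T \<le> c * (\<Sum>i\<in>{i \<in> {k+1..n}. \<theta> i \<ge> \<theta> k / 2}. (\<theta> k)\<^sup>2 / (\<theta> k - \<theta> i)\<^sup>2)"
  shows "measure_pmf.prob (labelled_run n \<theta> D) {(\<pi>, R). R = \<pi> ` {1..k}} \<le> 7 / 8"
proof -
  let ?P = "{\<pi>. \<pi> permutes {1..n}}"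
  define B where "B = {i \<in> {k+1..n}. \<theta> i \<ge> \<theta> k / 2}"
  note T = T[folded B_def]
  define N where "N = (\<lambda>i. (\<Sum>\<pi>\<in>?P. expected_wins (\<lambda>a. \<theta> (inv \<pi> a)) D (\<pi> i)) / fact n)"
  have wpos: "0 < \<theta> (inv \<pi> j)" if "\<pi> \<in> ?P" "j \<in> {1..n}" for \<pi> j
    using that pos permutes_in_image[OF permutes_inv, of \<pi> "{1..n}" j] by simp
  have N0: "0 \<le> N i" for i
    unfolding N_def by (auto intro!: divide_nonneg_nonneg sum_nonneg expected_wins_nonneg[OF D(1)] wpos)
  \<comment> \<open>For each \<pi>, distinct items carry distinct labels, so the bound on the wins
    of labels transfers to items.\<close>
  have sumN: "sum N U \<le> real T" if "finite U" for U
  proof -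
    have "sum N U = (\<Sum>\<pi>\<in>?P. \<Sum>i\<in>U. expected_wins (\<lambda>a. \<theta> (inv \<pi> a)) D (\<pi> i)) / fact n"
      unfolding N_def by (simp add: sum.swap[of _ U] flip: sum_divide_distrib)
    also have "\<dots> \<le> (\<Sum>\<pi>\<in>?P. real T) / fact n"
    proof (intro divide_right_mono sum_mono)
      fix \<pi> assume \<pi>: "\<pi> \<in> ?P"
      then have "inj_on \<pi> U" by (auto intro: inj_on_subset permutes_inj)
      then have "(\<Sum>i\<in>U. expected_wins (\<lambda>a. \<theta> (inv \<pi> a)) D (\<pi> i))
          = sum (expected_wins (\<lambda>a. \<theta> (inv \<pi> a)) D) (\<pi> ` U)"
        by (simp add: sum.reindex)
      also have "\<dots> \<le> real T"
        by (rule sum_expected_wins_le[OF D(1) _ D(2)]) (use wpos \<pi> that in auto)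
      finally show "(\<Sum>i\<in>U. expected_wins (\<lambda>a. \<theta> (inv \<pi> a)) D (\<pi> i)) \<le> real T" .
    qed simp
    also have "\<dots> = real T" using card_permutations[of "{1..n}" n] by simp
    finally show ?thesis .
  qed
  have lt: "\<theta> i < \<theta> k" if "i \<in> {k+1..n}" for i
    using that mono[of "k + 1" i] gap by auto
  have "\<exists>i\<in>{k+1..n}. ((\<theta> k - \<theta> i) / \<theta> i)\<^sup>2 * N i \<le> 4 / 10 ^ 4"
  proof (cases "B = {}")
    \<comment> \<open>The budget is then 0, so no item ever wins; \<open>k + 1\<close> serves as
      witness.\<close>
    case True
    then have "T = 0" using T by simp
    then have "N (k + 1) = 0" using sumN[of "{k + 1}"] N0[of "k + 1"] by simp
    then show ?thesis using k by (intro bexI[of _ "k + 1"]) auto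
  next
    case False
    \<comment> \<open>Pigeonhole: if every item of \<open>B\<close> exceeded its summand of the
      budget, the total number of wins would exceed \<open>T\<close>.\<close>
    have "\<exists>i\<in>B. N i \<le> c * ((\<theta> k)\<^sup>2 / (\<theta> k - \<theta> i)\<^sup>2)"
    proof (rule ccontr)
      assume "\<not> ?thesis"
      then have "(\<Sum>i\<in>B. c * ((\<theta> k)\<^sup>2 / (\<theta> k - \<theta> i)\<^sup>2)) < sum N B"
        using False by (intro sum_strict_mono) (auto simp: B_def)
      then show False
        using sumN[of B] T by (simp add: sum_distrib_left B_def)
    qed
    then obtain i where i: "i \<in> {k+1..n}" "\<theta> k / 2 \<le> \<theta> i"
      and Ni: "N i \<le> c * ((\<theta> k)\<^sup>2 / (\<theta> k - \<theta> i)\<^sup>2)"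
      by (auto simp: B_def)
    define d where "d = \<theta> k - \<theta> i"
    have d: "0 < d" using lt[OF i(1)] by (simp add: d_def)
    have \<theta>: "0 < \<theta> k" "0 < \<theta> i" using pos k i by auto
    \<comment> \<open>The restriction to scores of at least \<open>\<theta> k / 2\<close> costs a
      factor 2 here, hence the 4 in \<open>4 * c\<close>.\<close>
    have "d / \<theta> i \<le> 2 * d / \<theta> k"
      using i(2) d \<theta> by (simp add: field_simps)
    then have "(d / \<theta> i)\<^sup>2 \<le> (2 * d / \<theta> k)\<^sup>2"
      using d \<theta> by (intro power_mono) auto
    then have "(d / \<theta> i)\<^sup>2 * N i \<le> (2 * d / \<theta> k)\<^sup>2 * N i"
      using N0 by (rule mult_right_mono)
    also have "\<dots> \<le> (2 * d / \<theta> k)\<^sup>2 * (c * ((\<theta> k)\<^sup>2 / d\<^sup>2))"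
      using Ni unfolding d_def by (rule mult_left_mono) simp
    also have "\<dots> = 4 * c"
      using d \<theta> by (simp add: field_simps power2_eq_square)
    finally show ?thesis
      using c i(1) by (intro bexI[of _ i]) (simp_all add: d_def)
  qed
  then obtain i where i: "i \<in> {k+1..n}" and Ni: "((\<theta> k - \<theta> i) / \<theta> i)\<^sup>2 * N i \<le> 4 / 10 ^ 4" by blast
  \<comment> \<open>Roughly balances the two error terms: \<open>(1 + ?t) / 2 = 0.51\<close> and
    \<open>4 / 10 ^ 4 / ?t = 0.02\<close>, in total 0.53.\<close>
  let ?t = "1 / 50 :: real"
  have "measure_pmf.prob (labelled_run n \<theta> D) {(\<pi>, R). R = \<pi> ` {1..k}}
      \<le> (exp ?t - 1) / (2 * ?t) + ((\<theta> k - \<theta> i) / \<theta> i)\<^sup>2 * N i / ?t"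
    using prob_top_k_le[of n D k i \<theta> ?t] D(1) k i lt[OF i] pos by (simp add: N_def)
  also have "\<dots> \<le> (?t + ?t\<^sup>2) / (2 * ?t) + 4 / 10 ^ 4 / ?t"
    using exp_bound[of ?t] Ni by (intro add_mono divide_right_mono) auto
  also have "\<dots> \<le> 7 / 8" by (simp add: power2_eq_square)
  finally show ?thesis .
qed

section \<open>Averaging over the seed\<close>

theorem theorem4:
  fixes n k T :: nat and \<theta> :: "nat \<Rightarrow> real" and c :: real
    and M :: "'r measure" and A :: "'r \<Rightarrow> algorithm"
  assumes "1 \<le> k" "k < n"
    and "\<And>i. i \<in> {1..n} \<Longrightarrow> 0 < \<theta> i"
    and "\<And>i j. 1 \<le> i \<Longrightarrow> i \<le> j \<Longrightarrow> j \<le> n \<Longrightarrow> \<theta> j \<le> \<theta> i"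
    and "\<theta> k > \<theta> (k + 1)"
    and "c < 1 / 10 ^ 4"
    and "randomized_algorithm n \<theta> M A"
    and "real T \<le> c * (\<Sum>i\<in>{i \<in> {k+1..n}. \<theta> i \<ge> \<theta> k / 2}. (\<theta> k)\<^sup>2 / (\<theta> k - \<theta> i)\<^sup>2)"
    and "\<And>r. r \<in> space M \<Longrightarrow> uses_at_most (A r) T"
  shows "success_prob n k \<theta> M A \<le> 7 / 8"
proof -
  interpret prob_space M using assms(7) by (simp add: randomized_algorithm_def)
  define g where "g = (\<lambda>r. measure_pmf.prob (labelled_run n \<theta> (A r)) {(\<pi>, R). R = \<pi> ` {1..k}})"
  have g: "g r \<le> 7 / 8" if "r \<in> space M" for r
  proof -
    have "valid_algorithm n (A r)"
      using assms(7) that by (simp add: randomized_algorithm_def)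
    then show ?thesis
      unfolding g_def
      using assms(1-6) assms(8) assms(9)[OF that]
      by (intro prob_top_k_le_seven_eighths[where c = c and T = T]) auto
  qed
  have "(\<integral>r. g r \<partial>M) \<le> 7 / 8"
  proof (cases "integrable M g")
    case True
    then show ?thesis using g by (intro integral_le_const) auto
  next
    \<comment> \<open>The Bochner integral of a non-integrable function is 0 by convention.\<close>
    case False
    then show ?thesis by (simp add: not_integrable_integral_eq)
  qed
  then show ?thesis by (simp add: success_prob_def g_def)
qed

end
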